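(* There is a family of Boolean functions $f$ on $n$ variables such that $size^{\rm ndc}(f) \leq 2n + o(n)$ and $size^{\rm dc}(f) = 3n - o(n)$.
   Context: $U_2$ denotes the set of all Boolean functions $\{0,1\}^2\to\{0,1\}$ except XOR and its complement, i.e. functions of the form $((x\oplus a)\wedge(y\oplus b))\oplus c$ with $a,b,c\in\{0,1\}$. A $U_2$-circuit is a circuit (directed acyclic graph with inputs labeled by variables or constants, a designated output node) in which every gate has fan-in 2 and is labeled by a function in $U_2$; its size is the number of gates. A nondeterministic circuit has actual inputs $x_1,\dots,x_n$ and additional guess inputs $y_1,\dots,y_m$, and computes $f$ with $f(x)=1$ iff some setting of the guess inputs makes the output 1; a deterministic circuit has no guess inputs. $size^{\rm dc}(f)$ (resp. $size^{\rm ndc}(f)$) is the size of the smallest deterministic (resp. nondeterministic) $U_2$-circuit computing $f$. *)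

theory Defs
  imports Complex_Main "HOL-Library.Landau_Symbols"
begin

text \<open>
  A Boolean function on \<open>n\<close> variables is a function on \<^typ>\<open>bool list\<close>, of which
  only the values on lists of length \<open>n\<close> matter.
\<close>

definition U2 :: "(bool \<Rightarrow> bool \<Rightarrow> bool) set" where
  "U2 = UNIV - {\<lambda>x y. x \<noteq> y, \<lambda>x y. x = y}"

text \<open>
  Besides the eight functions \<open>((x \<oplus> a) \<and> (y \<oplus> b)) \<oplus> c\<close>, \<open>U2\<close> contains the six functions
  that depend on at most one argument. As circuits may read constants, one gate of the
  former kind can replace a gate of the latter kind, so both readings of the basis
  give the same circuit size.
\<close>

lemma U2_iff:
  "g \<in> U2 \<longleftrightarrow> (\<exists>a b c. g = (\<lambda>x y. ((x \<noteq> a) \<and> (y \<noteq> b)) \<noteq> c)) \<or>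
              (\<exists>h. g = (\<lambda>x y. h x)) \<or> (\<exists>h. g = (\<lambda>x y. h y))"
proof -
  have "(g = g') \<longleftrightarrow> g True True = g' True True \<and> g True False = g' True False \<and>
      g False True = g' False True \<and> g False False = g' False False"
    for g g' :: "bool \<Rightarrow> bool \<Rightarrow> bool"
    by (auto simp: fun_eq_iff all_bool_eq)
  note ext2 = this
  have ex: "(\<exists>h. P (h True) (h False)) \<longleftrightarrow> (\<exists>a b. P a b)" for P :: "bool \<Rightarrow> bool \<Rightarrow> bool"
  proof
    assume "\<exists>a b. P a b"
    then obtain a b where "P a b" by blast
    then show "\<exists>h. P (h True) (h False)"
      by (intro exI[of _ "\<lambda>x. if x then a else b"]) simp
  qed blast
  show ?thesis
    unfolding U2_def ext2
    using ex[of "\<lambda>p q. g True True = p \<and> g True False = p \<and> g False True = q \<and> g False False = q"]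
      ex[of "\<lambda>p q. g True True = p \<and> g True False = q \<and> g False True = p \<and> g False False = q"]
    by (cases "g True True"; cases "g True False"; cases "g False True"; cases "g False False")
      (simp_all add: ext2 ex_bool_eq)
qed

datatype node = Const bool | Input nat | Guess nat | Gate nat

text \<open>
  Gates carry arbitrary names. The two incoming wires of a gate are ordered, and both
  may come from the same node.
\<close>

record circuit =
  gates :: "nat set"
  label :: "nat \<Rightarrow> bool \<Rightarrow> bool \<Rightarrow> bool"
  left :: "nat \<Rightarrow> node"
  right :: "nat \<Rightarrow> node"
  out_node :: node

definition nodes :: "nat \<Rightarrow> nat \<Rightarrow> circuit \<Rightarrow> node set" where
  "nodes n m C = range Const \<union> Input ` {..<n} \<union> Guess ` {..<m} \<union> Gate ` gates C"

definition wires :: "circuit \<Rightarrow> (node \<times> node) set" where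
  "wires C = {(u, Gate g) | u g. g \<in> gates C \<and> (u = left C g \<or> u = right C g)}"

definition U2_circuit :: "nat \<Rightarrow> nat \<Rightarrow> circuit \<Rightarrow> bool" where
  "U2_circuit n m C \<longleftrightarrow>
     finite (gates C) \<and>
     (\<forall>g\<in>gates C. label C g \<in> U2 \<and> left C g \<in> nodes n m C \<and> right C g \<in> nodes n m C) \<and>
     out_node C \<in> nodes n m C \<and>
     acyclic (wires C)"

definition circuit_size :: "circuit \<Rightarrow> nat" where
  "circuit_size C = card (gates C)"

inductive has_value :: "circuit \<Rightarrow> bool list \<Rightarrow> bool list \<Rightarrow> node \<Rightarrow> bool \<Rightarrow> bool"
  for C x y where
  Const: "has_value C x y (Const b) b"
| Input: "i < length x \<Longrightarrow> has_value C x y (Input i) (x ! i)"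
| Guess: "j < length y \<Longrightarrow> has_value C x y (Guess j) (y ! j)"
| Gate: "\<lbrakk>g \<in> gates C; has_value C x y (left C g) a; has_value C x y (right C g) b\<rbrakk>
    \<Longrightarrow> has_value C x y (Gate g) (label C g a b)"

lemma has_value_unique:
  assumes "has_value C x y u a" and "has_value C x y u b"
  shows "a = b"
  using assms
proof (induction arbitrary: b rule: has_value.induct)
  case (Gate g a a')
  from Gate.prems show ?case
    by cases (use Gate.IH in blast)
qed (auto elim: has_value.cases)

lemma U2_circuit_has_value:
  assumes C: "U2_circuit n m C" and x: "length x = n" and y: "length y = m"
    and u: "u \<in> nodes n m C"
  shows "\<exists>!b. has_value C x y u b"
proof -
  have "wires C \<subseteq> (\<lambda>g. (left C g, Gate g)) ` gates C \<union> (\<lambda>g. (right C g, Gate g)) ` gates C"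
    by (auto simp: wires_def)
  then have "finite (wires C)"
    using C by (meson U2_circuit_def finite_UnI finite_imageI finite_subset)
  then have "wf (wires C)"
    using C by (simp add: U2_circuit_def finite_acyclic_wf)
  then have "u \<in> nodes n m C \<longrightarrow> (\<exists>b. has_value C x y u b)"
  proof (induction u rule: wf_induct_rule)
    case (less u)
    show ?case
    proof
      assume u: "u \<in> nodes n m C"
      show "\<exists>b. has_value C x y u b"
      proof (cases u)
        case (Gate g)
        then have g: "g \<in> gates C" using u by (auto simp: nodes_def)
        then have "(left C g, u) \<in> wires C" "(right C g, u) \<in> wires C"
          by (auto simp: wires_def Gate)
        moreover have "left C g \<in> nodes n m C" "right C g \<in> nodes n m C"
          using C g by (auto simp: U2_circuit_def)
        ultimately show ?thesis
          using less.IH g has_value.Gate unfolding Gate by metis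
      qed (use u x y in \<open>auto simp: nodes_def intro: has_value.intros\<close>)
    qed
  qed
  then show ?thesis using u has_value_unique by blast
qed

definition computes_dc :: "nat \<Rightarrow> circuit \<Rightarrow> (bool list \<Rightarrow> bool) \<Rightarrow> bool" where
  "computes_dc n C f \<longleftrightarrow>
     U2_circuit n 0 C \<and>
     (\<forall>x. length x = n \<longrightarrow> has_value C x [] (out_node C) (f x))"

definition computes_ndc :: "nat \<Rightarrow> nat \<Rightarrow> circuit \<Rightarrow> (bool list \<Rightarrow> bool) \<Rightarrow> bool" where
  "computes_ndc n m C f \<longleftrightarrow>
     U2_circuit n m C \<and>
     (\<forall>x. length x = n \<longrightarrow>
        (f x \<longleftrightarrow> (\<exists>y. length y = m \<and> has_value C x y (out_node C) True)))"

definition size_dc :: "nat \<Rightarrow> (bool list \<Rightarrow> bool) \<Rightarrow> nat" where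
  "size_dc n f = (LEAST s. \<exists>C. computes_dc n C f \<and> circuit_size C = s)"

definition size_ndc :: "nat \<Rightarrow> (bool list \<Rightarrow> bool) \<Rightarrow> nat" where
  "size_ndc n f = (LEAST s. \<exists>m C. computes_ndc n m C f \<and> circuit_size C = s)"

end

theory Submission
  imports Defs "HOL-Library.Discrete_Functions" "HOL-Real_Asymp.Real_Asymp"
begin

text \<open>
  With \<open>t = \<lfloor>\<surd>n\<rfloor>\<close>, the function is the disjunction of the parities of \<open>t\<close> disjoint
  blocks of \<open>t\<close> variables. A nondeterministic circuit guesses a block, selects it with two
  gates per variable and computes a single parity of \<open>t\<close> bits. The deterministic lower bound
  is Schnorr's gate elimination for parity: in a minimal circuit a gate \<open>g\<close> of minimal rank
  reads two variables \<open>x\<^sub>i, x\<^sub>j\<close>; the variable \<open>x\<^sub>i\<close> has another reader, as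
  otherwise a value of \<open>x\<^sub>j\<close> would hide it; and the value of \<open>x\<^sub>i\<close> making \<open>g\<close> constant
  removes \<open>g\<close>, the other reader and a successor. This is repeated until one variable of a
  block is left, which is then fixed for free so that the block becomes false.
\<close>

section \<open>Straight-line programs and gate elimination\<close>

text \<open>Closure under negated arguments lets a gate that reads the complement of a node read the
  node itself, at no cost.\<close>

lemma U2_negate_args:
  "h \<in> U2 \<Longrightarrow> (\<lambda>p q. h (p \<noteq> c) (q \<noteq> d)) \<in> U2"
  unfolding U2_def by (cases c; cases d) (auto simp: fun_eq_iff all_bool_eq)

text \<open>The value at a guess is a dummy: \<open>sources\<close> contains no guess nodes.\<close>

fun node_sem :: "(nat \<Rightarrow> (nat \<Rightarrow> bool) \<Rightarrow> bool) \<Rightarrow> node \<Rightarrow> (nat \<Rightarrow> bool) \<Rightarrow> bool" where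
  "node_sem F (Const b) x = b"
| "node_sem F (Input i) x = x i"
| "node_sem F (Guess j) x = False"
| "node_sem F (Gate g) x = F g x"

definition sources :: "nat set \<Rightarrow> nat set \<Rightarrow> node set" where
  "sources V G = range Const \<union> Input ` V \<union> Gate ` G"

definition below :: "nat set \<Rightarrow> (nat \<Rightarrow> nat) \<Rightarrow> nat \<Rightarrow> nat set" where
  "below G rk g = {k \<in> G. rk k < rk g}"

text \<open>
  A circuit without guesses, in which the labels are replaced by the functions \<open>F g\<close>
  computed at the gates, and acyclicity is witnessed by a rank function.
\<close>

definition slp :: "nat set \<Rightarrow> nat set \<Rightarrow> (nat \<Rightarrow> nat) \<Rightarrow> (nat \<Rightarrow> node) \<Rightarrow> (nat \<Rightarrow> node) \<Rightarrow>
    (nat \<Rightarrow> (nat \<Rightarrow> bool) \<Rightarrow> bool) \<Rightarrow> bool" where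
  "slp V G rk L R F \<longleftrightarrow> finite G \<and>
     (\<forall>g\<in>G. L g \<in> sources V (below G rk g) \<and> R g \<in> sources V (below G rk g) \<and>
        (\<exists>h\<in>U2. \<forall>x. F g x = h (node_sem F (L g) x) (node_sem F (R g) x)))"

text \<open>The output is taken up to a negation \<open>d\<close>, since moving it past a removed
  gate may leave the complement.\<close>

definition outputs :: "nat set \<Rightarrow> nat set \<Rightarrow> (nat \<Rightarrow> (nat \<Rightarrow> bool) \<Rightarrow> bool) \<Rightarrow> node \<Rightarrow>
    ((nat \<Rightarrow> bool) \<Rightarrow> bool) \<Rightarrow> bool" where
  "outputs V G F u f \<longleftrightarrow> u \<in> sources V G \<and> (\<exists>d. \<forall>x. f x = (node_sem F u x \<noteq> d))"

text \<open>The substitute \<open>u\<close> is a constant, a variable or a gate of smaller rank, so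
  rewiring the readers of \<open>g\<close> to \<open>u\<close> respects \<open>rk\<close>.\<close>

definition redundant :: "nat set \<Rightarrow> nat set \<Rightarrow> (nat \<Rightarrow> nat) \<Rightarrow> (nat \<Rightarrow> (nat \<Rightarrow> bool) \<Rightarrow> bool) \<Rightarrow>
    nat \<Rightarrow> bool" where
  "redundant V G rk F g \<longleftrightarrow>
     (\<exists>u\<in>sources V (below G rk g). \<exists>d. \<forall>x. F g x = (node_sem F u x \<noteq> d))"

section \<open>Removal of gates\<close>

text \<open>Readers of \<open>g\<close> are rewired to its substitute, and a negation is absorbed
  into their labels by \<open>U2_negate_args\<close>. The functions \<open>F\<close> and the ranks
  stay untouched.\<close>

lemma remove_redundant_gate:
  assumes S: "slp V G rk L R F" and out: "outputs V G F w f" and g: "g \<in> G"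
    and red: "redundant V G rk F g"
  obtains L' R' w' where "slp V (G - {g}) rk L' R' F" "outputs V (G - {g}) F w' f"
proof -
  obtain u d where u: "u \<in> sources V (below G rk g)" and ud: "\<And>x. F g x = (node_sem F u x \<noteq> d)"
    using red by (auto simp: redundant_def)
  define re where "re v = (if v = Gate g then u else v)" for v
  define neg where "neg v = (v = Gate g \<and> d)" for v
  have sem: "node_sem F v x = (node_sem F (re v) x \<noteq> neg v)" for v x
    using ud[of x] by (auto simp: re_def neg_def)
  have u': "u \<in> sources V (G - {g})"
    using u by (auto simp: sources_def below_def)
  have re_below: "re v \<in> sources V (below (G - {g}) rk k)"
    if "v \<in> sources V (below G rk k)" for v k
  proof (cases "v = Gate g")
    case True
    then have "rk g < rk k"
      using that by (auto simp: sources_def below_def)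
    then show ?thesis
      using u True by (auto simp: re_def sources_def below_def)
  next
    case False
    then show ?thesis
      using that by (auto simp: re_def sources_def below_def)
  qed
  have "slp V (G - {g}) rk (re \<circ> L) (re \<circ> R) F"
    unfolding slp_def
  proof (intro conjI ballI)
    show "finite (G - {g})"
      using S by (simp add: slp_def)
    fix k assume k: "k \<in> G - {g}"
    then show "(re \<circ> L) k \<in> sources V (below (G - {g}) rk k)"
      "(re \<circ> R) k \<in> sources V (below (G - {g}) rk k)"
      using S re_below by (auto simp: slp_def)
    obtain h where h: "h \<in> U2" and Fk: "\<And>x. F k x = h (node_sem F (L k) x) (node_sem F (R k) x)"
      using S k unfolding slp_def by blast
    show "\<exists>h\<in>U2. \<forall>x. F k x = h (node_sem F ((re \<circ> L) k) x) (node_sem F ((re \<circ> R) k) x)"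
      by (intro bexI[OF _ U2_negate_args[OF h, of "neg (L k)" "neg (R k)"]] allI)
        (simp only: Fk o_def sem[symmetric])
  qed
  moreover have "outputs V (G - {g}) F (re w) f"
  proof -
    obtain e where e: "\<And>x. f x = (node_sem F w x \<noteq> e)"
      using out by (auto simp: outputs_def)
    have "re w \<in> sources V (G - {g})"
      using out u' by (auto simp: outputs_def re_def sources_def)
    moreover have "f x = (node_sem F (re w) x \<noteq> (neg w \<noteq> e))" for x
      using e[of x] sem[of w x] by auto
    ultimately show ?thesis
      by (auto simp: outputs_def)
  qed
  ultimately show ?thesis
    by (rule that)
qed

text \<open>A substitution makes several gates redundant at once, all relative to the same program.
  The substitute of one gate may be another gate of \<open>E\<close>, so the order of removal
  matters.\<close>

lemma remove_redundant_gates: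
  assumes "slp V G rk L R F" and "outputs V G F w f" and "E \<subseteq> G"
    and "\<And>g. g \<in> E \<Longrightarrow> redundant V G rk F g"
  obtains L' R' w' where "slp V (G - E) rk L' R' F" "outputs V (G - E) F w' f"
proof -
  have "finite E"
    using assms(1,3) finite_subset by (auto simp: slp_def)
  then have "\<exists>L' R' w'. slp V (G - E) rk L' R' F \<and> outputs V (G - E) F w' f"
    using assms
  proof (induction "card E" arbitrary: E G L R w)
    case 0
    then show ?case by auto
  next
    case (Suc n)
    have "E \<noteq> {}" "finite (rk ` E)"
      using Suc.hyps(2) Suc.prems(1) by auto
    then have "Max (rk ` E) \<in> rk ` E"
      by (intro Max_in) auto
    \<comment> \<open>Removing a gate of maximal rank keeps the witnesses of redundancy of the others.\<close>
    then obtain g where "g \<in> E" and g: "rk g = Max (rk ` E)"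
      by (metis imageE)
    then have max: "rk k \<le> rk g" if "k \<in> E" for k
      using Max_ge[OF \<open>finite (rk ` E)\<close>, of "rk k"] that by simp
    have "g \<in> G" "redundant V G rk F g"
      using Suc.prems \<open>g \<in> E\<close> by auto
    then obtain L' R' w' where *: "slp V (G - {g}) rk L' R' F" "outputs V (G - {g}) F w' f"
      using remove_redundant_gate[OF Suc.prems(2,3)] by blast
    have "redundant V (G - {g}) rk F k" if "k \<in> E - {g}" for k
    proof -
      have "below (G - {g}) rk k = below G rk k"
        using max[of k] that by (auto simp: below_def)
      then show ?thesis
        using Suc.prems(5)[of k] that by (simp add: redundant_def)
    qed
    moreover have "n = card (E - {g})" "finite (E - {g})" "E - {g} \<subseteq> G - {g}"
      using Suc.hyps(2) Suc.prems(1,4) \<open>g \<in> E\<close> by auto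
    ultimately have "\<exists>L' R' w'. slp V (G - {g} - (E - {g})) rk L' R' F \<and>
        outputs V (G - {g} - (E - {g})) F w' f"
      using Suc.hyps(1) * by metis
    moreover have "G - {g} - (E - {g}) = G - E"
      using \<open>g \<in> E\<close> by blast
    ultimately show ?case by simp
  qed
  then show ?thesis
    using that by blast
qed

lemma remove_dead_gate:
  assumes S: "slp V G rk L R F" and out: "outputs V G F w f"
    and "w \<noteq> Gate g" and "\<And>k. k \<in> G \<Longrightarrow> L k \<noteq> Gate g \<and> R k \<noteq> Gate g"
  shows "slp V (G - {g}) rk L R F" "outputs V (G - {g}) F w f"
proof -
  have "u \<in> sources V (below (G - {g}) rk k)"
    if "u \<in> sources V (below G rk k)" "u \<noteq> Gate g" for u k
    using that by (auto simp: sources_def below_def)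
  then show "slp V (G - {g}) rk L R F"
    using S assms(4) by (auto simp: slp_def)
  show "outputs V (G - {g}) F w f"
    using out assms(3) by (auto simp: outputs_def sources_def)
qed

section \<open>Substituting a constant for a variable\<close>

definition fix_input :: "nat \<Rightarrow> bool \<Rightarrow> node \<Rightarrow> node" where
  "fix_input i c u = (if u = Input i then Const c else u)"

lemma node_sem_fix_input:
  "node_sem (\<lambda>g x. F g (x(i := c))) (fix_input i c u) x = node_sem F u (x(i := c))"
  by (cases u) (auto simp: fix_input_def)

lemma fix_input_sources:
  "u \<in> sources V G \<Longrightarrow> fix_input i c u \<in> sources (V - {i}) G"
  by (auto simp: sources_def fix_input_def)

text \<open>The labels stay the same; only the wires from \<open>Input i\<close> now come from a
  constant. No gate disappears yet, but gates may become redundant.\<close>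

lemma restrict_slp:
  assumes "slp V G rk L R F"
  shows "slp (V - {i}) G rk (fix_input i c \<circ> L) (fix_input i c \<circ> R) (\<lambda>g x. F g (x(i := c)))"
  unfolding slp_def
proof (intro conjI ballI)
  fix g assume g: "g \<in> G"
  then show "(fix_input i c \<circ> L) g \<in> sources (V - {i}) (below G rk g)"
    "(fix_input i c \<circ> R) g \<in> sources (V - {i}) (below G rk g)"
    using assms by (auto simp: slp_def fix_input_sources)
  obtain h where "h \<in> U2" "\<And>x. F g x = h (node_sem F (L g) x) (node_sem F (R g) x)"
    using assms g unfolding slp_def by blast
  then show "\<exists>h\<in>U2. \<forall>x. F g (x(i := c)) =
      h (node_sem (\<lambda>g x. F g (x(i := c))) ((fix_input i c \<circ> L) g) x)
        (node_sem (\<lambda>g x. F g (x(i := c))) ((fix_input i c \<circ> R) g) x)"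
    by (intro bexI[of _ h]) (simp_all add: node_sem_fix_input)
qed (use assms in \<open>simp add: slp_def\<close>)

lemma restrict_outputs:
  assumes "outputs V G F w f"
  shows "outputs (V - {i}) G (\<lambda>g x. F g (x(i := c))) (fix_input i c w) (\<lambda>x. f (x(i := c)))"
proof -
  obtain d where "w \<in> sources V G" and d: "\<And>x. f x = (node_sem F w x \<noteq> d)"
    using assms unfolding outputs_def by blast
  then have "fix_input i c w \<in> sources (V - {i}) G"
    by (simp add: fix_input_sources)
  moreover have "f (x(i := c)) =
      (node_sem (\<lambda>g x. F g (x(i := c))) (fix_input i c w) x \<noteq> d)" for x
    using d by (simp only: node_sem_fix_input)
  ultimately show ?thesis
    unfolding outputs_def by (intro conjI exI[of _ d] allI)
qed

lemma redundant_const: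
  assumes "\<And>x. F g x = d"
  shows "redundant V G rk F g"
proof -
  have "Const d \<in> sources V (below G rk g)"
    by (simp add: sources_def)
  moreover have "F g x = (node_sem F (Const d) x \<noteq> False)" for x
    using assms by simp
  ultimately show ?thesis
    unfolding redundant_def by blast
qed

text \<open>A unary Boolean function is constant, the identity or negation, and
  \<open>redundant\<close> allows for each.\<close>

lemma redundant_unary:
  assumes u: "u \<in> sources V (below G rk g)" and h: "\<And>x. F g x = h (node_sem F u x)"
  shows "redundant V G rk F g"
proof (cases "h True = h False")
  case True
  have "h p = h True" for p
    using True by (cases p) auto
  then show ?thesis
    using h redundant_const[of F g "h True"] by simp
next
  case False
  then have "h p = (p \<noteq> h False)" for p
    by (cases p) auto
  then show ?thesis
    using u h unfolding redundant_def by blast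
qed

lemma redundant_const_arg:
  assumes S: "slp V G rk L R F" and g: "g \<in> G"
    and c: "(\<forall>x. node_sem F (L g) x = c) \<or> (\<forall>x. node_sem F (R g) x = c)"
  shows "redundant V G rk F g"
proof -
  obtain h where h: "\<And>x. F g x = h (node_sem F (L g) x) (node_sem F (R g) x)"
    and LR: "L g \<in> sources V (below G rk g)" "R g \<in> sources V (below G rk g)"
    using S g unfolding slp_def by blast
  from c show ?thesis
  proof
    assume "\<forall>x. node_sem F (L g) x = c"
    then show ?thesis
      using h by (intro redundant_unary[OF LR(2), of F "h c"]) simp
  next
    assume "\<forall>x. node_sem F (R g) x = c"
    then show ?thesis
      using h by (intro redundant_unary[OF LR(1), of F "\<lambda>p. h p c"]) simp
  qed
qed

section \<open>The elimination step\<close>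

text \<open>The assumption \<open>dep\<close> isolates what is used of parity: fixing one variable
  never hides another. Minimality is asked only among programs with the same \<open>rk\<close> and
  \<open>F\<close>, which suffices because the removal lemmas preserve both. The variable
  \<open>i\<close> and the value \<open>c\<close> are dictated by the program, not by the
  caller.\<close>

lemma eliminate_three_gates:
  assumes S: "slp V G rk L R F" and out: "outputs V G F w f"
    and min: "\<And>G' L' R' w'. slp V G' rk L' R' F \<Longrightarrow> outputs V G' F w' f \<Longrightarrow> card G \<le> card G'"
    and dep: "\<And>i j c. i \<in> V \<Longrightarrow> j \<in> V \<Longrightarrow> i \<noteq> j \<Longrightarrow>
      \<exists>x. x j = c \<and> f x \<noteq> f (x(i := \<not> x i))"
    and two: "p \<in> V" "q \<in> V" "p \<noteq> q"
  obtains i c G' L' R' F' w' where "i \<in> V" "slp (V - {i}) G' rk L' R' F'"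
    "outputs (V - {i}) G' F' w' (\<lambda>x. f (x(i := c)))" "card G' + 3 \<le> card G"
proof -
  have fin: "finite G"
    using S by (simp add: slp_def)
  have nonred: "\<not> redundant V G rk F g" if g: "g \<in> G" for g
  proof
    assume "redundant V G rk F g"
    then obtain L' R' w' where "slp V (G - {g}) rk L' R' F" "outputs V (G - {g}) F w' f"
      using remove_redundant_gate[OF S out g] by blast
    then have "card G \<le> card (G - {g})"
      by (rule min)
    then show False
      using card_Diff1_less[OF fin g] by simp
  qed
  have succ: "\<exists>k\<in>G. L k = Gate g \<or> R k = Gate g" if g: "g \<in> G" "w \<noteq> Gate g" for g
  proof (rule ccontr)
    assume "\<not> ?thesis"
    then have "card G \<le> card (G - {g})"
      by (intro min[OF remove_dead_gate[OF S out]]) (use g in auto)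
    then show False
      using card_Diff1_less[OF fin g(1)] by simp
  qed
  obtain e where fw: "\<And>x. f x = (node_sem F w x \<noteq> e)" and wsrc: "w \<in> sources V G"
    using out unfolding outputs_def by blast
  \<comment> \<open>A bare variable as output would make \<open>f\<close> insensitive to every other
    variable, against \<open>dep\<close>.\<close>
  have w_input: "w \<noteq> Input k" for k
  proof
    assume w: "w = Input k"
    obtain l where l: "l \<in> V" "l \<noteq> k"
      using two by metis
    moreover have "k \<in> V"
      using wsrc w by (auto simp: sources_def)
    ultimately obtain x where "f x \<noteq> f (x(l := \<not> x l))"
      using dep[OF \<open>l \<in> V\<close> \<open>k \<in> V\<close> \<open>l \<noteq> k\<close>] by blast
    then show False
      using fw w l by simp
  qed
  obtain x where "f x \<noteq> f (x(p := \<not> x p))"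
    using dep[OF two] by blast
  then have "w \<noteq> Const b" for b
    unfolding fw by (cases w) simp_all
  then have "G \<noteq> {}"
    using w_input wsrc by (auto simp: sources_def)
  define g where "g = arg_min_on rk G"
  have g: "g \<in> G" and "\<not> (\<exists>k\<in>G. rk k < rk g)"
    using fin \<open>G \<noteq> {}\<close> arg_min_if_finite[of G rk] by (auto simp: g_def)
  then have first: "below G rk g = {}"
    by (auto simp: below_def)
  have LR: "L g \<in> sources V {}" "R g \<in> sources V {}"
    using S g first by (auto simp: slp_def)
  obtain h where h: "h \<in> U2" "\<And>x. F g x = h (node_sem F (L g) x) (node_sem F (R g) x)"
    using S g unfolding slp_def by blast
  have "L g \<noteq> Const b" "R g \<noteq> Const b" for b
    using nonred[OF g] redundant_const_arg[OF S g, of b] by auto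
  then obtain i j where ij: "L g = Input i" "R g = Input j" "i \<in> V" "j \<in> V"
    using LR by (auto simp: sources_def)
  have "i \<noteq> j"
    using nonred[OF g] h(2) redundant_unary[of "Input i" V G rk g F "\<lambda>p. h p p"] ij first LR
    by auto
  \<comment> \<open>A label that depends on one argument would make \<open>g\<close> redundant, so
    the label is of AND type. Then \<open>a\<close> is the value of \<open>x i\<close>, and
    \<open>b\<close> the value of \<open>x j\<close>, that makes \<open>g\<close> constant.\<close>
  have "\<nexists>h'. h = (\<lambda>p q. h' p)"
    using nonred[OF g] h(2) redundant_unary[of "Input i" V G rk g F] ij first LR by auto
  moreover have "\<nexists>h'. h = (\<lambda>p q. h' q)"
    using nonred[OF g] h(2) redundant_unary[of "Input j" V G rk g F] ij first LR by auto
  ultimately obtain a b c where "h = (\<lambda>p q. ((p \<noteq> a) \<and> (q \<noteq> b)) \<noteq> c)"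
    using U2_iff[THEN iffD1, OF h(1)] by blast
  then have Fg: "F g x = (((x i \<noteq> a) \<and> (x j \<noteq> b)) \<noteq> c)" for x
    using h(2) ij by simp
  have "\<exists>k\<in>G - {g}. L k = Input i \<or> R k = Input i"
  proof (rule ccontr)
    assume no: "\<not> ?thesis"
    \<comment> \<open>With \<open>x j = b\<close> the gate \<open>g\<close> ignores
      \<open>x i\<close>, and no other gate reads it; by induction along the ranks no gate notices a
      flip of \<open>x i\<close>.\<close>
    have indep: "F k (x(i := \<not> x i)) = F k x" if "k \<in> G" "x j = b" for k x
      using that(1)
    proof (induction "rk k" arbitrary: k rule: less_induct)
      case less
      show ?case
      proof (cases "k = g")
        case True
        then show ?thesis
          using Fg that(2) \<open>i \<noteq> j\<close> by simp
      next
        case False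
        have "node_sem F u (x(i := \<not> x i)) = node_sem F u x"
          if u: "u \<in> sources V (below G rk k)" "u \<noteq> Input i" for u
          using u less.hyps by (auto simp: sources_def below_def)
        moreover have "L k \<noteq> Input i" "R k \<noteq> Input i"
          using no False less.prems by auto
        moreover obtain h' where "\<And>x. F k x = h' (node_sem F (L k) x) (node_sem F (R k) x)"
          using S less.prems unfolding slp_def by blast
        moreover have "L k \<in> sources V (below G rk k)" "R k \<in> sources V (below G rk k)"
          using S less.prems by (auto simp: slp_def)
        ultimately show ?thesis
          by simp
      qed
    qed
    obtain x where "x j = b" "f x \<noteq> f (x(i := \<not> x i))"
      using dep[OF ij(3,4) \<open>i \<noteq> j\<close>] by blast
    then show False
      using fw indep w_input wsrc by (auto simp: sources_def)
  qed
  then obtain g' where g': "g' \<in> G" "g' \<noteq> g" "L g' = Input i \<or> R g' = Input i"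
    by blast
  define F' where "F' k x = F k (x(i := a))" for k x
  define L' where "L' = fix_input i a \<circ> L"
  define R' where "R' = fix_input i a \<circ> R"
  note F'_eq = F'_def[abs_def, symmetric]
  have S': "slp (V - {i}) G rk L' R' F'"
    using restrict_slp[OF S, of i a] by (simp add: F'_eq L'_def R'_def)
  have out': "outputs (V - {i}) G F' (fix_input i a w) (\<lambda>x. f (x(i := a)))"
    using restrict_outputs[OF out, of i a] by (simp add: F'_eq)
  \<comment> \<open>With \<open>x i\<close> fixed to \<open>a\<close>, \<open>f\<close> still
    depends on \<open>x j\<close>. Hence a gate that became constant is not the output, and
    \<open>succ\<close> gives it a reader.\<close>
  have not_out: "w \<noteq> Gate k" if "\<And>x. F' k x = d" for k d
  proof
    assume w: "w = Gate k"
    obtain x where x: "x i = a" "f x \<noteq> f (x(j := \<not> x j))"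
      using dep[OF ij(4,3) \<open>i \<noteq> j\<close>[symmetric]] by blast
    have "F k y = d" if "y i = a" for y
      using \<open>\<And>x. F' k x = d\<close>[of y] that by (simp add: F'_def fun_upd_idem)
    then show False
      using x fw w \<open>i \<noteq> j\<close> by simp
  qed
  have reader: "redundant (V - {i}) G rk F' k"
    if "k \<in> G" "L k = Gate l \<or> R k = Gate l" "\<And>x. F' l x = d" for k l d
    using that by (intro redundant_const_arg[OF S', of _ d])
      (auto simp: L'_def R'_def fix_input_def)
  have rk_less: "rk l < rk k" if "k \<in> G" "L k = Gate l \<or> R k = Gate l" for k l
    using S that by (auto simp: slp_def sources_def below_def)
  have g_const: "F' g x = c" for x
    by (simp add: F'_def Fg)
  have red_g: "redundant (V - {i}) G rk F' g"
    by (rule redundant_const) (rule g_const)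
  have red_g': "redundant (V - {i}) G rk F' g'"
    using g'(3) by (intro redundant_const_arg[OF S' g'(1), of a])
      (auto simp: L'_def R'_def fix_input_def)
  \<comment> \<open>The third gate is a reader \<open>s\<close> of \<open>g\<close>, redundant
    because \<open>g\<close> is now constant. Only if \<open>s\<close> coincides with
    \<open>g'\<close> must one go a gate further.\<close>
  obtain k where k: "k \<in> G" "k \<noteq> g" "k \<noteq> g'" "redundant (V - {i}) G rk F' k"
  proof -
    obtain s where s: "s \<in> G" "L s = Gate g \<or> R s = Gate g"
      using succ[OF g] not_out[OF g_const] by blast
    have "rk g < rk s"
      using rk_less[OF s] .
    show ?thesis
    proof (cases "s = g'")
      case False
      then show ?thesis
        using that[of s] s reader[OF s g_const] \<open>rk g < rk s\<close> by blast
    next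
      case True
      \<comment> \<open>Both inputs of \<open>g'\<close> are now constant, so that its own reader is redundant.\<close>
      obtain h' where h': "\<And>x. F' g' x = h' (node_sem F' (L' g') x) (node_sem F' (R' g') x)"
        using S' g'(1) unfolding slp_def by blast
      have "(L g' = Gate g \<and> R g' = Input i) \<or> (L g' = Input i \<and> R g' = Gate g)"
        using s(2) g'(3) True by auto
      then have "F' g' x = (if L g' = Gate g then h' c a else h' a c)" for x
        unfolding h'[of x] using g_const[of x] by (auto simp: L'_def R'_def fix_input_def)
      then obtain d where d: "\<And>x. F' g' x = d"
        by blast
      then obtain s' where s': "s' \<in> G" "L s' = Gate g' \<or> R s' = Gate g'"
        using succ[OF g'(1)] not_out[of g'] by blast
      have "rk g' < rk s'"
        using rk_less[OF s'] .
      then have "s' \<noteq> g" "s' \<noteq> g'"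
        using \<open>rk g < rk s\<close> True by auto
      then show ?thesis
        using that[of s'] s'(1) reader[OF s' d] by blast
    qed
  qed
  obtain L'' R'' w'' where "slp (V - {i}) (G - {g, g', k}) rk L'' R'' F'"
    "outputs (V - {i}) (G - {g, g', k}) F' w'' (\<lambda>x. f (x(i := a)))"
    by (rule remove_redundant_gates[OF S' out', of "{g, g', k}"])
      (use g g'(1) k red_g red_g' in auto)
  moreover have "card (G - {g, g', k}) + 3 = card G"
  proof -
    have "card {g, g', k} = 3"
      using g'(2) k(2,3) by auto
    then show ?thesis
      using g g'(1) k(1) fin card_Diff_subset[of "{g, g', k}" G] card_mono[of G "{g, g', k}"]
      by auto
  qed
  ultimately show ?thesis
    using that ij(3) by (metis order_refl)
qed

section \<open>Disjunctions of parities\<close>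

text \<open>The map \<open>bl\<close> assigns variables to blocks; the offset \<open>a b\<close>
  records the constants already substituted into block \<open>b\<close>.\<close>

definition block_parity :: "(nat \<Rightarrow> nat) \<Rightarrow> nat set \<Rightarrow> (nat \<Rightarrow> bool) \<Rightarrow> nat \<Rightarrow> (nat \<Rightarrow> bool) \<Rightarrow> bool"
  where "block_parity bl V a b x \<longleftrightarrow> odd (card {i \<in> V. bl i = b \<and> x i}) \<noteq> a b"

text \<open>Only blocks that still have a variable in \<open>V\<close> take part, so an exhausted
  block drops out of the disjunction.\<close>

definition or_parity :: "(nat \<Rightarrow> nat) \<Rightarrow> nat set \<Rightarrow> (nat \<Rightarrow> bool) \<Rightarrow> (nat \<Rightarrow> bool) \<Rightarrow> bool"
  where "or_parity bl V a x \<longleftrightarrow> (\<exists>b\<in>bl ` V. block_parity bl V a b x)"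

lemma block_parity_restrict:
  assumes "finite V" "i \<in> V"
  shows "block_parity bl V a b (x(i := c)) =
    block_parity bl (V - {i}) (a(bl i := a (bl i) \<noteq> c)) b x"
proof -
  let ?A = "{k \<in> V - {i}. bl k = b \<and> x k}"
  have "{k \<in> V. bl k = b \<and> (x(i := c)) k} = (if bl i = b \<and> c then insert i ?A else ?A)"
    using assms(2) by auto
  moreover have "finite ?A" "i \<notin> ?A"
    using assms(1) by auto
  ultimately show ?thesis
    unfolding block_parity_def by (cases c) auto
qed

text \<open>The companion \<open>j\<close> keeps the block present, so the substituted value only
  shifts its offset.\<close>

lemma or_parity_restrict:
  assumes "finite V" "i \<in> V" "j \<in> V - {i}" "bl j = bl i"
  shows "or_parity bl V a (x(i := c)) = or_parity bl (V - {i}) (a(bl i := a (bl i) \<noteq> c)) x"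
proof -
  have "bl ` V = bl ` (V - {i})"
    using assms(2-4) by (metis insert_Diff image_insert insert_absorb image_eqI)
  then show ?thesis
    using block_parity_restrict[OF assms(1,2)] by (simp add: or_parity_def)
qed

text \<open>A block reduced to \<open>i\<close> computes \<open>x i \<noteq> a (bl i)\<close>, so
  the value \<open>a (bl i)\<close> makes it false and the block leaves the disjunction.\<close>

lemma or_parity_restrict_last:
  assumes "finite V" "i \<in> V" "\<And>j. j \<in> V - {i} \<Longrightarrow> bl j \<noteq> bl i"
  shows "or_parity bl V a (x(i := a (bl i))) = or_parity bl (V - {i}) a x"
proof -
  have img: "bl ` V = insert (bl i) (bl ` (V - {i}))"
    using assms(2) by (metis image_insert insert_Diff)
  have notin: "bl i \<notin> bl ` (V - {i})"
    using assms(3) by (metis imageE)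
  have none: "{k \<in> V - {i}. bl k = bl i \<and> x k} = {}"
    using assms(3) by auto
  have "\<not> block_parity bl V a (bl i) (x(i := a (bl i)))"
    unfolding block_parity_restrict[OF assms(1,2)] unfolding block_parity_def none by simp
  moreover have "block_parity bl V a b (x(i := a (bl i))) = block_parity bl (V - {i}) a b x"
    if "b \<noteq> bl i" for b
    using that unfolding block_parity_restrict[OF assms(1,2)] by (simp add: block_parity_def)
  ultimately show ?thesis
    unfolding or_parity_def img using notin by (metis insert_iff)
qed

text \<open>Flipping a variable flips the parity of its own block, and one true block
  suffices.\<close>

lemma or_parity_flip:
  assumes "finite V" "i \<in> V" "\<not> or_parity bl V a x"
  shows "or_parity bl V a (x(i := \<not> x i))"
proof -
  \<comment> \<open>Writing \<open>x\<close> as \<open>x(i := x i)\<close> makes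
    \<open>block_parity_restrict\<close> applicable to both sides.\<close>
  have "block_parity bl V a (bl i) (x(i := \<not> x i)) \<noteq> block_parity bl V a (bl i) (x(i := x i))"
    unfolding block_parity_restrict[OF assms(1,2)] by (simp add: block_parity_def)
  then show ?thesis
    using assms(2,3) by (auto simp: or_parity_def)
qed

text \<open>Every block has a variable other than \<open>j\<close>, so each parity can be made false
  without touching \<open>x j\<close>.\<close>

lemma or_parity_false:
  assumes j: "j \<in> V" and two: "\<And>i. i \<in> V \<Longrightarrow> \<exists>k\<in>V - {i}. bl k = bl i"
  shows "\<exists>x. x j = c \<and> \<not> or_parity bl V a x"
proof -
  have *: "\<forall>b\<in>bl ` V. \<exists>k. k \<in> V \<and> k \<noteq> j \<and> bl k = b"
  proof
    fix b assume "b \<in> bl ` V"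
    then obtain i where "i \<in> V" "b = bl i" by blast
    then show "\<exists>k. k \<in> V \<and> k \<noteq> j \<and> bl k = b"
      using two[OF \<open>i \<in> V\<close>] by (cases "i = j") auto
  qed
  then obtain r where r: "\<And>b. b \<in> bl ` V \<Longrightarrow> r b \<in> V \<and> r b \<noteq> j \<and> bl (r b) = b"
    using bchoice[OF *] by blast
  \<comment> \<open>The representative \<open>r b\<close> of each block corrects the parity of the block.\<close>
  define x where "x k = (if k = j then c else k = r (bl k) \<and> (a (bl k) \<noteq> (bl j = bl k \<and> c)))" for k
  have "\<not> block_parity bl V a b x" if b: "b \<in> bl ` V" for b
  proof -
    have "i \<in> V \<and> bl i = b \<and> x i \<longleftrightarrow>
        (i = r b \<and> a b \<noteq> (bl j = b \<and> c)) \<or> (i = j \<and> bl j = b \<and> c)" for i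
      using r[OF b] j by (cases "i = j"; cases "bl i = b") (simp_all add: x_def, blast+)
    then have "{i \<in> V. bl i = b \<and> x i} =
        (if a b \<noteq> (bl j = b \<and> c) then {r b} else {}) \<union> (if bl j = b \<and> c then {j} else {})"
      by (cases "bl j = b \<and> c"; cases "a b") auto
    moreover have "r b \<noteq> j"
      using r[OF b] by simp
    ultimately show ?thesis
      unfolding block_parity_def by (cases "bl j = b \<and> c"; cases "a b") simp_all
  qed
  moreover have "x j = c"
    by (simp add: x_def)
  ultimately show ?thesis
    by (auto simp: or_parity_def)
qed

lemma or_parity_depends:
  assumes "finite V" "i \<in> V" "j \<in> V" "i \<noteq> j" "\<And>i. i \<in> V \<Longrightarrow> \<exists>k\<in>V - {i}. bl k = bl i"
  shows "\<exists>x. x j = c \<and> or_parity bl V a x \<noteq> or_parity bl V a (x(i := \<not> x i))"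
  using or_parity_false[OF assms(3,5)] or_parity_flip[OF assms(1,2)] by metis

text \<open>Each variable except the last of its block costs three gates, in whatever order the
  elimination step picks them. The offsets vary in the induction, while \<open>rk\<close> survives
  every restriction and stays fixed.\<close>

lemma or_parity_lower_bound:
  assumes "finite V" and "\<And>i. i \<in> V \<Longrightarrow> \<exists>j\<in>V - {i}. bl j = bl i"
    and "slp V G rk L R F" and "outputs V G F w (or_parity bl V a)"
  shows "3 * card V \<le> card G + 3 * card (bl ` V)"
  using assms
proof (induction "card V" arbitrary: V a G L R F w rule: less_induct)
  case less
  note fin = less.prems(1) and two = less.prems(2)
  show ?case
  proof (cases "V = {}")
    case False
    then obtain p where p: "p \<in> V" by blast
    then obtain q where q: "q \<in> V" "p \<noteq> q"
      using two by blast
    \<comment> \<open>Least size is taken among the programs with the same \<open>rk\<close> and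
      \<open>F\<close>, which is the minimality that \<open>eliminate_three_gates\<close>
      assumes.\<close>
    define Q where "Q s \<longleftrightarrow> (\<exists>G L R w. slp V G rk L R F \<and>
      outputs V G F w (or_parity bl V a) \<and> card G = s)" for s
    have "Q (card G)"
      using less.prems(3,4) by (auto simp: Q_def)
    then have "Q (Least Q)" and "Least Q \<le> card G"
      by (auto intro: LeastI Least_le)
    then obtain G0 L0 R0 w0 where S0: "slp V G0 rk L0 R0 F"
      and out0: "outputs V G0 F w0 (or_parity bl V a)" and "card G0 = Least Q"
      by (auto simp: Q_def)
    then have min: "card G0 \<le> card G'"
      if "slp V G' rk L' R' F" "outputs V G' F w' (or_parity bl V a)" for G' L' R' w'
    proof -
      have "Q (card G')"
        using that unfolding Q_def by blast
      then show ?thesis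
        using \<open>card G0 = Least Q\<close> by (simp add: Least_le)
    qed
    have dep: "\<exists>x. x j = c \<and> or_parity bl V a x \<noteq> or_parity bl V a (x(i := \<not> x i))"
      if "i \<in> V" "j \<in> V" "i \<noteq> j" for i j c
      by (rule or_parity_depends[OF fin that two])
    obtain i c G1 L1 R1 F1 w1 where i: "i \<in> V" and S1: "slp (V - {i}) G1 rk L1 R1 F1"
      and out1: "outputs (V - {i}) G1 F1 w1 (\<lambda>x. or_parity bl V a (x(i := c)))"
      and G1: "card G1 + 3 \<le> card G0"
      by (rule eliminate_three_gates[OF S0 out0 min dep p q(1,2)])
    define a1 where "a1 = a(bl i := a (bl i) \<noteq> c)"
    obtain j where j: "j \<in> V - {i}" "bl j = bl i"
      using two i by blast
    have f1: "(\<lambda>x. or_parity bl V a (x(i := c))) = or_parity bl (V - {i}) a1"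
      using or_parity_restrict[where bl = bl, OF fin i j] by (simp add: a1_def fun_eq_iff)
    have other: "\<exists>k\<in>V - {l}. bl k = bl l \<and> bl k \<noteq> bl i" if "l \<in> V" "bl l \<noteq> bl i" for l
      using two[OF that(1)] that(2) by auto
    have img: "bl ` (V - {i}) = bl ` V"
      using i j by (metis insert_Diff image_insert insert_absorb image_eqI)
    have "card V = Suc (card (V - {i}))"
      using i fin by (metis card_Suc_Diff1)
    note card = this \<open>Least Q \<le> card G\<close> \<open>card G0 = Least Q\<close> G1
    show ?thesis
    proof (cases "\<exists>k\<in>V - {i, j}. bl k = bl i")
      case True
      then obtain k where k: "k \<in> V - {i, j}" "bl k = bl i" by blast
      have "3 * card (V - {i}) \<le> card G1 + 3 * card (bl ` (V - {i}))"
      proof (rule less.hyps[OF _ _ _ S1 out1[unfolded f1]])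
        fix l assume l: "l \<in> V - {i}"
        show "\<exists>k\<in>V - {i} - {l}. bl k = bl l"
          using l j k other[of l] by (cases "bl l = bl i"; cases "l = j") auto
      qed (use card fin in auto)
      then show ?thesis
        using card unfolding img by linarith
    next
      case False
      \<comment> \<open>Only \<open>j\<close> is left in the block of \<open>i\<close>. Fixing it
        removes no further gate, but the number of blocks drops by one, which pays for the lost
        variable.\<close>
      have S2: "slp (V - {i} - {j}) G1 rk (fix_input j (a1 (bl j)) \<circ> L1)
          (fix_input j (a1 (bl j)) \<circ> R1) (\<lambda>g x. F1 g (x(j := a1 (bl j))))"
        by (rule restrict_slp[OF S1])
      have "(\<lambda>x. or_parity bl (V - {i}) a1 (x(j := a1 (bl j)))) =
          or_parity bl (V - {i} - {j}) a1"
        using False j fin by (intro ext or_parity_restrict_last) auto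
      then have out2: "outputs (V - {i} - {j}) G1 (\<lambda>g x. F1 g (x(j := a1 (bl j))))
          (fix_input j (a1 (bl j)) w1) (or_parity bl (V - {i} - {j}) a1)"
        using restrict_outputs[OF out1[unfolded f1], of j "a1 (bl j)"] by simp
      have card2: "card (V - {i}) = Suc (card (V - {i} - {j}))"
        using j fin by (metis card_Suc_Diff1 finite_Diff)
      have "bl ` V = insert (bl i) (bl ` (V - {i} - {j}))" "bl i \<notin> bl ` (V - {i} - {j})"
        using i j False by auto
      then have "card (bl ` V) = Suc (card (bl ` (V - {i} - {j})))"
        using fin by simp
      moreover have "3 * card (V - {i} - {j}) \<le> card G1 + 3 * card (bl ` (V - {i} - {j}))"
      proof (rule less.hyps[OF _ _ _ S2 out2])
        fix l assume l: "l \<in> V - {i} - {j}"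
        then have "bl l \<noteq> bl i"
          using False by auto
        then show "\<exists>k\<in>V - {i} - {j} - {l}. bl k = bl l"
          using other[of l] l j by auto
      qed (use card card2 fin in auto)
      ultimately show ?thesis
        using card card2 by linarith
    qed
  qed simp
qed

section \<open>Padding variables, and passage from circuits to straight-line programs\<close>

text \<open>Disposes of the variables that lie outside all blocks before the lower bound is
  applied.\<close>

lemma restrict_to_false:
  assumes "finite W" "slp V G rk L R F" "outputs V G F w f"
  shows "\<exists>L' R' F' w'. slp (V - W) G rk L' R' F' \<and>
    outputs (V - W) G F' w' (\<lambda>x. f (\<lambda>i. if i \<in> W then False else x i))"
  using assms(1)
proof (induction W rule: finite_induct)
  case empty
  then show ?case
    using assms(2,3) by auto
next
  case (insert k W)
  then obtain L' R' F' w' where "slp (V - W) G rk L' R' F'"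
    "outputs (V - W) G F' w' (\<lambda>x. f (\<lambda>i. if i \<in> W then False else x i))"
    by blast
  note * = restrict_slp[OF this(1), of k False] restrict_outputs[OF this(2), of k False]
  have set: "V - W - {k} = V - insert k W"
    by blast
  have fn: "(\<lambda>x. f (\<lambda>i. if i \<in> W then False else (x(k := False)) i)) =
      (\<lambda>x. f (\<lambda>i. if i \<in> insert k W then False else x i))"
    by (intro ext arg_cong[of _ _ f]) auto
  show ?case
    by (intro exI conjI) (rule *(1)[unfolded set], rule *(2)[unfolded set fn])
qed

lemma circuit_slp:
  assumes "computes_dc n C f"
  obtains rk F where "slp {..<n} (gates C) rk (left C) (right C) F"
    "outputs {..<n} (gates C) F (out_node C) (\<lambda>x. f (map x [0..<n]))"
proof -
  have C: "U2_circuit n 0 C"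
    and val: "\<And>x. length x = n \<Longrightarrow> has_value C x [] (out_node C) (f x)"
    using assms by (auto simp: computes_dc_def)
  define F where "F g x = (THE b. has_value C (map x [0..<n]) [] (Gate g) b)" for g x
  \<comment> \<open>The number of gates from which \<open>g\<close> is reachable grows strictly
    along wires: by acyclicity \<open>k\<close> is counted for its reader but not for
    itself.\<close>
  define rk where "rk g = card {k. (Gate k, Gate g) \<in> (wires C)\<^sup>+}" for g
  have nodes: "nodes n 0 C = sources {..<n} (gates C)"
    by (auto simp: nodes_def sources_def)
  have sem: "has_value C (map x [0..<n]) [] u (node_sem F u x)" if u: "u \<in> nodes n 0 C" for u x
  proof (cases u)
    case (Input i)
    then have "i < n"
      using u by (auto simp: nodes_def)
    then show ?thesis
      using has_value.Input[of i "map x [0..<n]" C "[]"] Input by simp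
  next
    case (Gate g)
    show ?thesis
      using theI'[OF U2_circuit_has_value[OF C _ _ u, of "map x [0..<n]" "[]"]] Gate
      by (simp add: F_def)
  qed (use u in \<open>auto simp: nodes_def intro: has_value.intros\<close>)
  have src: "left C g \<in> nodes n 0 C" "right C g \<in> nodes n 0 C" "label C g \<in> U2"
    if "g \<in> gates C" for g
    using C that by (auto simp: U2_circuit_def)
  have pred: "k \<in> gates C" if "(Gate k, u) \<in> (wires C)\<^sup>+" for k u
    using that by (rule converse_tranclE; use src in \<open>force simp: wires_def nodes_def\<close>)
  have fin: "finite (gates C)"
    using C by (simp add: U2_circuit_def)
  have rk_less: "rk k < rk g" if "(Gate k, Gate g) \<in> wires C" for k g
    unfolding rk_def
  proof (rule psubset_card_mono)
    show "finite {k. (Gate k, Gate g) \<in> (wires C)\<^sup>+}"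
      using pred by (intro finite_subset[OF _ fin]) auto
    have "(Gate k, Gate k) \<notin> (wires C)\<^sup>+"
      using C by (auto simp: U2_circuit_def acyclic_def)
    then show "{l. (Gate l, Gate k) \<in> (wires C)\<^sup>+} \<subset> {k. (Gate k, Gate g) \<in> (wires C)\<^sup>+}"
      using that by (auto intro: trancl_into_trancl)
  qed
  have below: "u \<in> sources {..<n} (below (gates C) rk g)"
    if "u \<in> nodes n 0 C" "(u, Gate g) \<in> wires C" for u g
    using that rk_less by (auto simp: nodes_def sources_def below_def)
  have "slp {..<n} (gates C) rk (left C) (right C) F"
    unfolding slp_def
  proof (intro conjI ballI)
    fix g assume g: "g \<in> gates C"
    show "left C g \<in> sources {..<n} (below (gates C) rk g)"
      "right C g \<in> sources {..<n} (below (gates C) rk g)"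
      using g src[OF g] by (auto intro!: below simp: wires_def)
    have "F g x = label C g (node_sem F (left C g) x) (node_sem F (right C g) x)" for x
      using has_value_unique[OF sem[of "Gate g" x] has_value.Gate[OF g sem sem]] src[OF g] g
      by (simp add: nodes_def)
    then show "\<exists>h\<in>U2. \<forall>x. F g x = h (node_sem F (left C g) x) (node_sem F (right C g) x)"
      using src(3)[OF g] by blast
  qed (rule fin)
  moreover have "outputs {..<n} (gates C) F (out_node C) (\<lambda>x. f (map x [0..<n]))"
  proof -
    have "out_node C \<in> nodes n 0 C"
      using C by (simp add: U2_circuit_def)
    moreover from this have "f (map x [0..<n]) = node_sem F (out_node C) x" for x
      using has_value_unique[OF val[of "map x [0..<n]"] sem] by simp
    ultimately show ?thesis
      unfolding outputs_def nodes by (intro conjI exI[of _ False]) auto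
  qed
  ultimately show ?thesis
    by (rule that)
qed

section \<open>The hard function and its deterministic lower bound\<close>

text \<open>Block \<open>b\<close> occupies the positions \<open>b * t\<close> to
  \<open>b * t + t - 1\<close>; positions from \<open>t * t\<close> on are ignored.\<close>

definition blocks_parity :: "nat \<Rightarrow> bool list \<Rightarrow> bool" where
  "blocks_parity t x \<longleftrightarrow> (\<exists>b<t. odd (card {j. j < t \<and> x ! (b * t + j)}))"

lemma block_index_less:
  fixes b j t :: nat
  assumes "b < t" "j < t"
  shows "b * t + j < t * t"
proof -
  have "b * t + j < Suc b * t"
    using assms by simp
  also have "\<dots> \<le> t * t"
    using assms by (intro mult_right_mono) auto
  finally show ?thesis .
qed

text \<open>Division with remainder by \<open>t\<close> identifies a variable with its block and its
  offset in the block.\<close>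

lemma blocks_parity_eq_or_parity:
  assumes "t * t \<le> n"
  shows "blocks_parity t (map y [0..<n]) =
    or_parity (\<lambda>i. i div t) {..<t * t} (\<lambda>_. False) y"
proof -
  have img: "(\<lambda>i. i div t) ` {..<t * t} = {..<t}"
  proof
    show "(\<lambda>i. i div t) ` {..<t * t} \<subseteq> {..<t}"
      by (auto simp: less_mult_imp_div_less)
    show "{..<t} \<subseteq> (\<lambda>i. i div t) ` {..<t * t}"
    proof
      fix b assume "b \<in> {..<t}"
      then show "b \<in> (\<lambda>i. i div t) ` {..<t * t}"
        using block_index_less[of b t 0] by (intro image_eqI[of _ _ "b * t"]) auto
    qed
  qed
  have "card {i \<in> {..<t * t}. i div t = b \<and> y i} =
      card {j. j < t \<and> map y [0..<n] ! (b * t + j)}" if b: "b < t" for b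
  proof (rule bij_betw_same_card[OF bij_betw_byWitness[where f' = "\<lambda>j. b * t + j"]])
    show "(\<lambda>i. i mod t) ` {i \<in> {..<t * t}. i div t = b \<and> y i} \<subseteq>
        {j. j < t \<and> map y [0..<n] ! (b * t + j)}"
      using assms b by auto
    show "(\<lambda>j. b * t + j) ` {j. j < t \<and> map y [0..<n] ! (b * t + j)} \<subseteq>
        {i \<in> {..<t * t}. i div t = b \<and> y i}"
      using block_index_less[OF b] assms by (fastforce simp: order.strict_trans2)
  qed auto
  then show ?thesis
    unfolding blocks_parity_def or_parity_def img block_parity_def by auto
qed

lemma blocks_parity_lower_bound:
  assumes t: "t * t \<le> n" and C: "computes_dc n C (blocks_parity t)"
  shows "3 * (t * t) \<le> circuit_size C + 3 * t"
proof (cases "t \<le> 1")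
  \<comment> \<open>Now \<open>t \<ge> 2\<close>, so every block has the two variables that
    \<open>or_parity_lower_bound\<close> requires. For \<open>t \<le> 1\<close> the slack
    \<open>3 * t\<close> covers the left-hand side.\<close>
  case False
  let ?bl = "\<lambda>i. i div t"
  let ?V = "{..<t * t}"
  obtain rk F where *: "slp {..<n} (gates C) rk (left C) (right C) F"
    "outputs {..<n} (gates C) F (out_node C) (\<lambda>x. blocks_parity t (map x [0..<n]))"
    using circuit_slp[OF C] by blast
  have "{..<n} - {t * t..<n} = ?V"
    using t by auto
  moreover have "or_parity ?bl ?V (\<lambda>_. False) (\<lambda>i. if i \<in> {t * t..<n} then False else x i) =
      or_parity ?bl ?V (\<lambda>_. False) x" for x
  proof -
    have "{i \<in> ?V. i div t = b \<and> (if i \<in> {t * t..<n} then False else x i)} =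
        {i \<in> ?V. i div t = b \<and> x i}" for b
      by auto
    then show ?thesis
      by (simp only: or_parity_def block_parity_def)
  qed
  ultimately obtain L R F' w where
    S: "slp ?V (gates C) rk L R F'" "outputs ?V (gates C) F' w (or_parity ?bl ?V (\<lambda>_. False))"
    using restrict_to_false[OF _ *, of "{t * t..<n}"]
    by (auto simp only: blocks_parity_eq_or_parity[OF t] finite_atLeastLessThan simp_thms)
  have "\<exists>j\<in>?V - {i}. ?bl j = ?bl i" if i: "i \<in> ?V" for i
  proof -
    \<comment> \<open>The first position of the block of \<open>i\<close>, or the second one if
      \<open>i\<close> is the first.\<close>
    define j where "j = i div t * t + (if i mod t = 0 then 1 else 0)"
    have div: "j div t = i div t"
      using False by (auto simp: j_def)
    moreover have "j mod t \<noteq> i mod t"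
      using False by (auto simp: j_def)
    moreover have "i div t < t"
      using i by (auto simp: less_mult_imp_div_less)
    then have "j < t * t"
      using False div by (metis div_less_iff_less_mult gr0I not_less_zero)
    ultimately show ?thesis
      by auto
  qed
  then have "3 * card ?V \<le> card (gates C) + 3 * card (?bl ` ?V)"
    by (intro or_parity_lower_bound[OF _ _ S]) auto
  moreover have "card (?bl ` ?V) \<le> card {..<t}"
    by (intro card_mono) (auto simp: less_mult_imp_div_less)
  ultimately show ?thesis
    by (simp add: circuit_size_def)
qed (cases t; simp)

section \<open>Circuit constructions\<close>

text \<open>A single circuit has to compute all functions of \<open>P\<close> at its nodes, so later
  gates can share intermediate results.\<close>

definition realizable :: "nat \<Rightarrow> nat \<Rightarrow> nat \<Rightarrow> (bool list \<Rightarrow> bool list \<Rightarrow> bool) set \<Rightarrow> bool" where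
  "realizable n m s P \<longleftrightarrow> (\<exists>C. U2_circuit n m C \<and> circuit_size C \<le> s \<and>
     (\<forall>p\<in>P. \<exists>u\<in>nodes n m C. \<forall>x y. length x = n \<longrightarrow> length y = m \<longrightarrow> has_value C x y u (p x y)))"

lemma realizable_mono:
  "realizable n m s P \<Longrightarrow> Q \<subseteq> P \<Longrightarrow> s \<le> s' \<Longrightarrow> realizable n m s' Q"
  unfolding realizable_def by (meson order_trans subsetD)

text \<open>The constant \<open>False\<close> starts the chains for parities and disjunctions; the
  gates this wastes are of lower order.\<close>

definition atoms :: "nat \<Rightarrow> nat \<Rightarrow> (bool list \<Rightarrow> bool list \<Rightarrow> bool) set" where
  "atoms n m = {\<lambda>x y. False} \<union> (\<lambda>i x y. x ! i) ` {..<n} \<union> (\<lambda>j x y. y ! j) ` {..<m}"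

lemma realizable_atoms: "realizable n m 0 (atoms n m)"
proof -
  define C where "C = \<lparr>gates = {}, label = \<lambda>_ _ _. False, left = \<lambda>_. Const False,
    right = \<lambda>_. Const False, out_node = Const False\<rparr>"
  have "U2_circuit n m C" "circuit_size C = 0"
    by (auto simp: U2_circuit_def circuit_size_def C_def nodes_def wires_def acyclic_def)
  moreover have "\<exists>u\<in>nodes n m C. \<forall>x y. length x = n \<longrightarrow> length y = m \<longrightarrow> has_value C x y u (p x y)"
    if "p \<in> atoms n m" for p
    using that unfolding atoms_def nodes_def
    by (elim UnE imageE) (force intro: has_value.intros)+
  ultimately show ?thesis
    unfolding realizable_def by (metis order_refl)
qed

lemma has_value_extend:
  assumes "has_value C x y u b" "gates C \<subseteq> gates D"
    and "\<And>g. g \<in> gates C \<Longrightarrow> label D g = label C g \<and> left D g = left C g \<and> right D g = right C g"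
  shows "has_value D x y u b"
  using assms(1)
proof (induction rule: has_value.induct)
  case (Gate g a b)
  then show ?case
    using has_value.Gate[of g D x y a b] assms(2,3) by auto
qed (auto intro: has_value.intros)

text \<open>A cycle through the new edge would have to leave \<open>v\<close>.\<close>

lemma acyclic_insert_sink:
  assumes "acyclic r" "v \<notin> Domain r" "u \<noteq> v"
  shows "acyclic (insert (u, v) r)"
  using assms by (auto simp: acyclic_insert elim: converse_rtranclE)

lemma realizable_gate:
  assumes "realizable n m s P" "p \<in> P" "q \<in> P" "h \<in> U2"
  shows "realizable n m (Suc s) (insert (\<lambda>x y. h (p x y) (q x y)) P)"
proof -
  obtain C where C: "U2_circuit n m C" "circuit_size C \<le> s"
    and P: "\<And>p. p \<in> P \<Longrightarrow> \<exists>u\<in>nodes n m C. \<forall>x y. length x = n \<longrightarrow> length y = m \<longrightarrow>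
      has_value C x y u (p x y)"
    using assms(1) unfolding realizable_def by blast
  obtain u where u: "u \<in> nodes n m C"
    "\<And>x y. length x = n \<Longrightarrow> length y = m \<Longrightarrow> has_value C x y u (p x y)"
    using P[OF assms(2)] by blast
  obtain v where v: "v \<in> nodes n m C"
    "\<And>x y. length x = n \<Longrightarrow> length y = m \<Longrightarrow> has_value C x y v (q x y)"
    using P[OF assms(3)] by blast
  have fin: "finite (gates C)"
    using C by (simp add: U2_circuit_def)
  then obtain g where g: "g \<notin> gates C"
    by (meson ex_new_if_finite infinite_UNIV_nat)
  define D where "D = C\<lparr>gates := insert g (gates C), label := (label C)(g := h),
    left := (left C)(g := u), right := (right C)(g := v)\<rparr>"
  have nodes_D: "nodes n m D = insert (Gate g) (nodes n m C)"
    by (auto simp: nodes_def D_def)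
  have ext: "has_value D x y w b" if "has_value C x y w b" for x y w b
    by (rule has_value_extend[OF that]) (use g in \<open>auto simp: D_def\<close>)
  have new: "Gate g \<notin> nodes n m C"
    using g by (auto simp: nodes_def)
  have wires_D: "wires D = insert (u, Gate g) (insert (v, Gate g) (wires C))"
    using g by (auto simp: wires_def D_def)
  have "acyclic (wires D)"
    unfolding wires_D using C u(1) v(1) new
    by (intro acyclic_insert_sink) (auto simp: U2_circuit_def wires_def)
  then have "U2_circuit n m D"
    using C u(1) v(1) assms(4) unfolding U2_circuit_def nodes_D by (auto simp: D_def)
  moreover have "circuit_size D \<le> Suc s"
    using C fin g by (simp add: circuit_size_def D_def)
  moreover have value_g: "has_value D x y (Gate g) (h (p x y) (q x y))"
    if "length x = n" "length y = m" for x y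
    using has_value.Gate[of g D x y "p x y" "q x y"] ext u(2) v(2) that by (simp add: D_def)
  ultimately show ?thesis
    unfolding realizable_def
  proof (intro exI[of _ D] conjI ballI)
    fix p' assume "p' \<in> insert (\<lambda>x y. h (p x y) (q x y)) P"
    then consider "p' = (\<lambda>x y. h (p x y) (q x y))" | "p' \<in> P" by blast
    then show "\<exists>u\<in>nodes n m D. \<forall>x y. length x = n \<longrightarrow> length y = m \<longrightarrow> has_value D x y u (p' x y)"
    proof cases
      case 1
      then show ?thesis
        using value_g nodes_D by (intro bexI[of _ "Gate g"]) auto
    next
      case 2
      then show ?thesis
        using P[OF 2] ext unfolding nodes_D by blast
    qed
  qed
qed

text \<open>The function \<open>p b\<close> may be built from \<open>P\<close> and all earlier
  members, which is how prefix disjunctions are chained.\<close>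

lemma realizable_family:
  assumes "realizable n m s P"
    and "\<And>b s Q. b < k \<Longrightarrow> P \<union> p ` {..<b} \<subseteq> Q \<Longrightarrow> realizable n m s Q \<Longrightarrow>
      realizable n m (s + c) (insert (p b) Q)"
  shows "realizable n m (s + k * c) (P \<union> p ` {..<k})"
  using assms(2)
proof (induction k)
  case 0
  then show ?case using assms(1) by simp
next
  case (Suc k)
  have "realizable n m (s + k * c + c) (insert (p k) (P \<union> p ` {..<k}))"
    by (rule Suc.prems) (auto intro!: Suc.IH Suc.prems)
  then show ?case
    by (simp add: lessThan_Suc algebra_simps)
qed

lemma U2_and_or:
  "(\<lambda>p q. p \<and> q) \<in> U2" "(\<lambda>p q. p \<or> q) \<in> U2" "(\<lambda>p q. p \<and> \<not> q) \<in> U2"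
  by (auto simp: U2_def fun_eq_iff all_bool_eq)

text \<open>XOR is not in \<open>U2\<close>; it is assembled as OR without AND, which explains the
  cost of three gates per bit of a parity.\<close>

lemma realizable_xor:
  assumes "realizable n m s P" "p \<in> P" "q \<in> P"
  shows "realizable n m (s + 3) (insert (\<lambda>x y. p x y \<noteq> q x y) P)"
proof -
  let ?a = "\<lambda>x y. p x y \<and> q x y" and ?o = "\<lambda>x y. p x y \<or> q x y"
  have "realizable n m (Suc s) (insert ?a P)"
    using realizable_gate[OF assms U2_and_or(1)] by simp
  then have "realizable n m (Suc (Suc s)) (insert ?o (insert ?a P))"
    using realizable_gate[OF _ _ _ U2_and_or(2), of n m "Suc s" "insert ?a P" p q] assms by simp
  then have "realizable n m (Suc (Suc (Suc s)))
      (insert (\<lambda>x y. ?o x y \<and> \<not> ?a x y) (insert ?o (insert ?a P)))"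
    using realizable_gate[OF _ _ _ U2_and_or(3), of n m "Suc (Suc s)" _ ?o ?a] by simp
  moreover have "(\<lambda>x y. ?o x y \<and> \<not> ?a x y) = (\<lambda>x y. p x y \<noteq> q x y)"
    by auto
  ultimately show ?thesis
    by (auto elim!: realizable_mono)
qed

lemma realizable_parity:
  assumes "realizable n m s P" "(\<lambda>x y. False) \<in> P" "\<And>j. j < k \<Longrightarrow> p j \<in> P"
  shows "realizable n m (s + 3 * k) (insert (\<lambda>x y. odd (card {j. j < k \<and> p j x y})) P)"
  using assms(3)
proof (induction k)
  case 0
  then show ?case using assms(1,2) by (simp add: insert_absorb)
next
  case (Suc k)
  let ?q = "\<lambda>x y. odd (card {j. j < k \<and> p j x y})"
  have "realizable n m (s + 3 * k + 3) (insert (\<lambda>x y. ?q x y \<noteq> p k x y) (insert ?q P))"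
    using Suc by (intro realizable_xor) auto
  moreover have "(\<lambda>x y. ?q x y \<noteq> p k x y) = (\<lambda>x y. odd (card {j. j < Suc k \<and> p j x y}))"
  proof (intro ext)
    fix x y
    have "{j. j < Suc k \<and> p j x y} =
        (if p k x y then insert k {j. j < k \<and> p j x y} else {j. j < k \<and> p j x y})"
      by (auto simp: less_Suc_eq)
    then show "(?q x y \<noteq> p k x y) = odd (card {j. j < Suc k \<and> p j x y})"
      by auto
  qed
  ultimately show ?case
    by (auto elim!: realizable_mono)
qed

lemma realizable_or:
  assumes "realizable n m s P" "(\<lambda>x y. False) \<in> P" "\<And>j. j < k \<Longrightarrow> p j \<in> P"
  shows "realizable n m (s + k) (insert (\<lambda>x y. \<exists>j<k. p j x y) P)"
  using assms(3)
proof (induction k)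
  case 0
  then show ?case using assms(1,2) by (simp add: insert_absorb)
next
  case (Suc k)
  let ?q = "\<lambda>x y. \<exists>j<k. p j x y"
  have "realizable n m (Suc (s + k)) (insert (\<lambda>x y. ?q x y \<or> p k x y) (insert ?q P))"
    using Suc by (intro realizable_gate[OF _ _ _ U2_and_or(2)]) auto
  moreover have "(\<lambda>x y. ?q x y \<or> p k x y) = (\<lambda>x y. \<exists>j<Suc k. p j x y)"
    by (auto simp: less_Suc_eq fun_eq_iff)
  ultimately show ?case
    by (auto elim!: realizable_mono)
qed

lemma realizable_circuit:
  assumes "realizable n m s P" "p \<in> P"
  obtains C where "U2_circuit n m C" "circuit_size C \<le> s"
    "\<And>x y. length x = n \<Longrightarrow> length y = m \<Longrightarrow> has_value C x y (out_node C) (p x y)"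
proof -
  obtain C u where C: "U2_circuit n m C" "circuit_size C \<le> s" "u \<in> nodes n m C"
    "\<And>x y. length x = n \<Longrightarrow> length y = m \<Longrightarrow> has_value C x y u (p x y)"
    using assms unfolding realizable_def by metis
  have "U2_circuit n m (C\<lparr>out_node := u\<rparr>)"
    using C(1,3) by (simp add: U2_circuit_def nodes_def wires_def)
  moreover have "has_value (C\<lparr>out_node := u\<rparr>) x y u (p x y)"
    if "length x = n" "length y = m" for x y
    by (rule has_value_extend[OF C(4)[OF that]]) auto
  ultimately show ?thesis
    using that C(2) by (simp add: circuit_size_def)
qed

lemma realizable_dc:
  assumes "realizable n 0 s P" "p \<in> P" "\<And>x. length x = n \<Longrightarrow> p x [] = f x"
  obtains C where "computes_dc n C f" "circuit_size C \<le> s"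
proof -
  obtain C where "U2_circuit n 0 C" "circuit_size C \<le> s"
    "\<And>x y. length x = n \<Longrightarrow> length y = 0 \<Longrightarrow> has_value C x y (out_node C) (p x y)"
    using realizable_circuit[OF assms(1,2)] by blast
  then show ?thesis
    using that[of C] assms(3) by (simp add: computes_dc_def)
qed

lemma realizable_ndc:
  assumes "realizable n m s P" "p \<in> P"
    and "\<And>x. length x = n \<Longrightarrow> f x \<longleftrightarrow> (\<exists>y. length y = m \<and> p x y)"
  shows "size_ndc n f \<le> s"
proof -
  obtain C where C: "U2_circuit n m C" "circuit_size C \<le> s"
    "\<And>x y. length x = n \<Longrightarrow> length y = m \<Longrightarrow> has_value C x y (out_node C) (p x y)"
    using realizable_circuit[OF assms(1,2)] by blast
  then have "has_value C x y (out_node C) True \<longleftrightarrow> p x y" if "length x = n" "length y = m" for x y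
    using that has_value_unique by metis
  then have "computes_ndc n m C f"
    using C(1) assms(3) by (auto simp: computes_ndc_def)
  then have "size_ndc n f \<le> circuit_size C"
    unfolding size_ndc_def by (intro Least_le) blast
  then show ?thesis
    using C(2) by simp
qed

section \<open>Upper bounds for the hard function\<close>

lemma false_atom: "(\<lambda>x y. False) \<in> atoms n m"
  by (simp add: atoms_def)

lemma input_atom:
  assumes "t * t \<le> n" "b < t" "j < t"
  shows "(\<lambda>x y. x ! (b * t + j)) \<in> atoms n m"
  using block_index_less[OF assms(2,3)] assms(1) by (auto simp: atoms_def)

text \<open>Three gates per bit for \<open>t\<close> parities, then \<open>t\<close> gates for the
  disjunction. The existence of a circuit also ensures that the \<open>LEAST\<close> in
  \<open>size_dc\<close> is attained.\<close>

lemma blocks_parity_dc: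
  assumes "t * t \<le> n"
  obtains C where "computes_dc n C (blocks_parity t)" "circuit_size C \<le> 3 * (t * t) + t"
proof -
  let ?p = "\<lambda>b x y :: bool list. odd (card {j. j < t \<and> x ! (b * t + j)})"
  have "realizable n 0 (0 + t * (3 * t)) (atoms n 0 \<union> ?p ` {..<t})"
  proof (rule realizable_family[OF realizable_atoms])
    fix b s Q
    assume *: "b < t" "atoms n 0 \<union> ?p ` {..<b} \<subseteq> Q" "realizable n 0 s Q"
    show "realizable n 0 (s + 3 * t) (insert (?p b) Q)"
      by (rule realizable_parity[OF *(3)])
        (use *(2) false_atom input_atom[OF assms \<open>b < t\<close>] in blast)+
  qed
  then have "realizable n 0 (0 + t * (3 * t) + t)
      (insert (\<lambda>x y. \<exists>b<t. ?p b x y) (atoms n 0 \<union> ?p ` {..<t}))"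
    by (rule realizable_or) (use false_atom in blast)+
  then show ?thesis
    by (rule realizable_dc[OF _ insertI1, where f = "blocks_parity t"])
      (auto simp: blocks_parity_def algebra_simps intro: that)
qed

text \<open>
  The block of the first guess set to true is selected; no validity check of the guess is
  needed, since the selected word is zero if no guess is set.
\<close>

lemma blocks_parity_select:
  "blocks_parity t x \<longleftrightarrow> (\<exists>y. length y = t \<and>
     odd (card {j. j < t \<and> (\<exists>b<t. (y ! b \<and> \<not> (\<exists>b'<b. y ! b')) \<and> x ! (b * t + j))}))"
  (is "_ \<longleftrightarrow> (\<exists>y. length y = t \<and> odd (card (?S y)))")
proof
  assume "blocks_parity t x"
  then obtain b where b: "b < t" "odd (card {j. j < t \<and> x ! (b * t + j)})"
    by (auto simp: blocks_parity_def)
  define y where "y = map (\<lambda>i. i = b) [0..<t]"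
  have y: "length y = t" "y ! i \<longleftrightarrow> i = b" if "i < t" for i
    using that by (simp_all add: y_def)
  have "y ! b' \<and> \<not> (\<exists>b''<b'. y ! b'') \<longleftrightarrow> b' = b" if "b' < t" for b'
    using y(2) that by (metis less_trans less_irrefl)
  then have "?S y = {j. j < t \<and> x ! (b * t + j)}"
    using b(1) by (intro Collect_cong) metis
  then show "\<exists>y. length y = t \<and> odd (card (?S y))"
    using b(2) by (intro exI[of _ y]) (simp add: y_def)
next
  assume "\<exists>y. length y = t \<and> odd (card (?S y))"
  then obtain y where y: "odd (card (?S y))" by blast
  then have "?S y \<noteq> {}"
    by (metis card.empty even_zero)
  then obtain b where b: "b < t" "y ! b" "\<not> (\<exists>b'<b. y ! b')"
    by blast
  have "y ! b' \<and> \<not> (\<exists>b''<b'. y ! b'') \<longleftrightarrow> b' = b" for b'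
    using b(2,3) by (metis linorder_neqE_nat)
  then have "?S y = {j. j < t \<and> x ! (b * t + j)}"
    using b(1) by (intro Collect_cong) metis
  then show "blocks_parity t x"
    using y b(1) unfolding blocks_parity_def by auto
qed

text \<open>The gates are \<open>t\<close> for the prefixes \<open>?pre\<close>, \<open>t\<close>
  for the selectors \<open>?sel\<close>, \<open>2 * t\<close> for each of the \<open>t\<close> bits
  \<open>?word\<close> of the selected block, and \<open>3 * t\<close> for the single
  parity.\<close>

lemma blocks_parity_ndc:
  assumes "t * t \<le> n"
  shows "size_ndc n (blocks_parity t) \<le> 2 * (t * t) + 5 * t"
proof -
  let ?pre = "\<lambda>b (x :: bool list) y. \<exists>b'<b. y ! b'"
  let ?sel = "\<lambda>b (x :: bool list) y. y ! b \<and> \<not> (\<exists>b'<b. y ! b')"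
  let ?and = "\<lambda>j b x y. (y ! b \<and> \<not> (\<exists>b'<b. y ! b')) \<and> x ! (b * t + j)"
  let ?word = "\<lambda>j x y. \<exists>b<t. (y ! b \<and> \<not> (\<exists>b'<b. y ! b')) \<and> x ! (b * t + j)"
  let ?P0 = "atoms n t"
  have guess: "(\<lambda>x y. y ! b) \<in> ?P0" if "b < t" for b
    using that by (auto simp: atoms_def)
  note false = false_atom[of n t]
  let ?P1 = "?P0 \<union> ?pre ` {..<t}"
  have P1: "realizable n t (0 + t * 1) ?P1"
  proof (rule realizable_family[OF realizable_atoms])
    fix b s Q
    assume *: "b < t" "?P0 \<union> ?pre ` {..<b} \<subseteq> Q" "realizable n t s Q"
    show "realizable n t (s + 1) (insert (?pre b) Q)"
    proof (cases b)
      \<comment> \<open>The empty prefix is the constant \<open>False\<close>, already an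
        atom.\<close>
      case 0
      then show ?thesis
        using * false by (auto simp: insert_absorb elim!: realizable_mono)
    next
      case (Suc c)
      have "realizable n t (Suc s) (insert (\<lambda>x y. ?pre c x y \<or> y ! c) Q)"
        using * Suc guess[of c] by (intro realizable_gate[OF _ _ _ U2_and_or(2)]) auto
      moreover have "(\<lambda>x y. ?pre c x y \<or> y ! c) = ?pre b"
        by (auto simp: Suc less_Suc_eq fun_eq_iff)
      ultimately show ?thesis by simp
    qed
  qed
  let ?P2 = "?P1 \<union> ?sel ` {..<t}"
  have P2: "realizable n t (0 + t * 1 + t * 1) ?P2"
  proof (rule realizable_family[OF P1])
    fix b s Q
    assume *: "b < t" "?P1 \<union> ?sel ` {..<b} \<subseteq> Q" "realizable n t s Q"
    then have "realizable n t (Suc s) (insert (?sel b) Q)"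
      using guess[of b] by (intro realizable_gate[OF _ _ _ U2_and_or(3)]) auto
    then show "realizable n t (s + 1) (insert (?sel b) Q)" by simp
  qed
  let ?P3 = "?P2 \<union> ?word ` {..<t}"
  have P3: "realizable n t (0 + t * 1 + t * 1 + t * (2 * t)) ?P3"
  proof (rule realizable_family[OF P2])
    fix j s Q
    assume *: "j < t" "?P2 \<union> ?word ` {..<j} \<subseteq> Q" "realizable n t s Q"
    let ?Q = "Q \<union> ?and j ` {..<t}"
    have Q: "realizable n t (s + t * 1) ?Q"
    proof (rule realizable_family[OF *(3)])
      fix b s Q'
      assume **: "b < t" "Q \<union> ?and j ` {..<b} \<subseteq> Q'" "realizable n t s Q'"
      then have "realizable n t (Suc s) (insert (?and j b) Q')"
        using * input_atom[OF assms **(1) *(1), of t]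
        by (intro realizable_gate[OF _ _ _ U2_and_or(1)]) auto
      then show "realizable n t (s + 1) (insert (?and j b) Q')" by simp
    qed
    have "realizable n t (s + t * 1 + t) (insert (?word j) ?Q)"
      by (rule realizable_or[OF Q]) (use * false in auto)
    then show "realizable n t (s + 2 * t) (insert (?word j) Q)"
      by (auto elim!: realizable_mono)
  qed
  have "realizable n t (0 + t * 1 + t * 1 + t * (2 * t) + 3 * t)
      (insert (\<lambda>x y. odd (card {j. j < t \<and> ?word j x y})) ?P3)"
    by (rule realizable_parity[OF P3]) (use false in auto)
  then have "size_ndc n (blocks_parity t) \<le> 0 + t * 1 + t * 1 + t * (2 * t) + 3 * t"
    by (rule realizable_ndc[OF _ insertI1]) (rule blocks_parity_select)
  then show ?thesis
    by simp
qed

lemma blocks_parity_size_dc: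
  assumes "t * t \<le> n"
  shows "size_dc n (blocks_parity t) \<le> 3 * (t * t) + t"
    and "3 * (t * t) \<le> size_dc n (blocks_parity t) + 3 * t"
proof -
  let ?Q = "\<lambda>s. \<exists>C. computes_dc n C (blocks_parity t) \<and> circuit_size C = s"
  obtain C where C: "computes_dc n C (blocks_parity t)" "circuit_size C \<le> 3 * (t * t) + t"
    using blocks_parity_dc[OF assms] .
  then have Q: "?Q (circuit_size C)" by blast
  show "size_dc n (blocks_parity t) \<le> 3 * (t * t) + t"
    using Least_le[of ?Q, OF Q] C(2) by (simp add: size_dc_def)
  show "3 * (t * t) \<le> size_dc n (blocks_parity t) + 3 * t"
    using LeastI[of ?Q, OF Q] blocks_parity_lower_bound[OF assms] unfolding size_dc_def by metis
qed

section \<open>Asymptotics\<close>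

lemma smallo_floor_sqrt_bound:
  fixes d :: "nat \<Rightarrow> real"
  assumes "\<And>n. \<bar>d n\<bar> \<le> c * real (floor_sqrt n)" "0 \<le> c"
  shows "d \<in> o(\<lambda>n. real n)"
proof (rule landau_o.big_small_trans)
  show "d \<in> O(\<lambda>n. sqrt (real n))"
  proof (rule bigoI)
    have "real (floor_sqrt n) \<le> sqrt (real n)" for n
      by (rule real_le_rsqrt) (metis floor_sqrt_power2_le of_nat_le_iff of_nat_power)
    then have "c * real (floor_sqrt n) \<le> c * sqrt (real n)" for n
      using assms(2) by (rule mult_left_mono)
    then have "\<bar>d n\<bar> \<le> c * sqrt (real n)" for n
      using assms(1) order_trans by blast
    then show "\<forall>\<^sub>F n in sequentially. norm (d n) \<le> c * norm (sqrt (real n))"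
      by simp
  qed
  show "(\<lambda>n. sqrt (real n)) \<in> o(\<lambda>n. real n)"
    by real_asymp
qed

theorem theorem2:
  "\<exists>f :: nat \<Rightarrow> bool list \<Rightarrow> bool.
     (\<exists>e :: nat \<Rightarrow> real. e \<in> o(\<lambda>n. real n) \<and>
        (\<forall>n. real (size_ndc n (f n)) \<le> 2 * real n + e n)) \<and>
     (\<exists>d :: nat \<Rightarrow> real. d \<in> o(\<lambda>n. real n) \<and>
        (\<forall>n. real (size_dc n (f n)) = 3 * real n - d n))"
proof -
  define f where "f n = blocks_parity (floor_sqrt n)" for n
  \<comment> \<open>The required equation holds by this choice; the content is that \<open>d\<close>
    is small in absolute value, which takes both bounds on \<open>size_dc\<close>.\<close>
  define d where "d n = 3 * real n - real (size_dc n (f n))" for n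
  have le: "floor_sqrt n * floor_sqrt n \<le> n" for n
    using floor_sqrt_power2_le[of n] by (simp add: power2_eq_square)
  \<comment> \<open>At most \<open>2 * floor_sqrt n\<close> variables lie outside the
    blocks.\<close>
  have ge: "n \<le> floor_sqrt n * floor_sqrt n + 2 * floor_sqrt n" for n
    using Suc_floor_sqrt_power2_gt[of n] by (simp add: power2_eq_square)
  have ndc: "real (size_ndc n (f n)) \<le> 2 * real n + 5 * real (floor_sqrt n)" for n
  proof -
    have "size_ndc n (f n) \<le> 2 * n + 5 * floor_sqrt n"
      using blocks_parity_ndc[OF le, of n] le[of n] unfolding f_def by linarith
    then show ?thesis by linarith
  qed
  \<comment> \<open>The variables outside the blocks account for 6 of the 9, and the loss of three
    gates per block for the other 3.\<close>
  have dc: "\<bar>d n\<bar> \<le> 9 * real (floor_sqrt n)" for n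
  proof -
    have "size_dc n (f n) \<le> 3 * n + 9 * floor_sqrt n" "3 * n \<le> size_dc n (f n) + 9 * floor_sqrt n"
      using blocks_parity_size_dc[OF le, of n] le[of n] ge[of n] unfolding f_def by linarith+
    then show ?thesis
      unfolding d_def by linarith
  qed
  show ?thesis
  proof (intro exI[of _ f] conjI)
    show "\<exists>e. e \<in> o(\<lambda>n. real n) \<and> (\<forall>n. real (size_ndc n (f n)) \<le> 2 * real n + e n)"
      using ndc by (intro exI[of _ "\<lambda>n. 5 * real (floor_sqrt n)"] conjI
        smallo_floor_sqrt_bound[of _ 5]) auto
    show "\<exists>d. d \<in> o(\<lambda>n. real n) \<and> (\<forall>n. real (size_dc n (f n)) = 3 * real n - d n)"
      using dc by (intro exI[of _ d] conjI smallo_floor_sqrt_bound[of _ 9]) (auto simp: d_def)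
  qed
qed

end
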